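(* Let $k \in \mathbb{N}$. The bijective sort transform of order $k$ is invertible: there is a function $g_k$ such that $g_k(\mathrm{LST}_k(w)) = w$ for every $w \in \Sigma^+$. Here, for $w$ of length $n$ with Lyndon factorization $w = v_s \cdots v_1$ ($v_s \geq \cdots \geq v_1$), if $M_k([v_1], \ldots, [v_s]) = (u_1, \ldots, u_n)$ then $\mathrm{LST}_k(w) = \mathrm{last}(u_1) \cdots \mathrm{last}(u_n)$.
   Context: $\Sigma$ is a finite non-empty alphabet with a linear order $\leq$; $\Sigma^+$ is the set of non-empty words; $\leq$ on words is the lexicographic order induced by the order on letters. For $w = a_1 \cdots a_n$: $\mathrm{last}(w) = a_n$; $r(w) = a_n a_1 \cdots a_{n-1}$ is the right-shift with iterates $r^i$; the ordered conjugacy class is the list $[w] = (r^0(w), r^1(w), \ldots, r^{n-1}(w))$, and $([v_1], \ldots, [v_s])$ denotes the concatenation of the lists $[v_1], \ldots, [v_s]$ in this order; $\mathrm{context}_k(w)$ is the prefix of length $k$ of the infinite word $w^\omega = www\cdots$. A Lyndon word is a non-empty word strictly lexicographically smaller than all its other rotations; the Lyndon factorization of $w$ is the unique factorization $w = v_s \cdots v_1$ into Lyndon words with $v_1 \leq \cdots \leq v_s$. For a list $V = (x_1, \ldots, x_n)$ of non-empty words, the $k$-order standard permutation $\nu_{k,V}$ is defined by ordering indices via $i \preceq j$ iff $\mathrm{context}_k(x_i) < \mathrm{context}_k(x_j)$, or $\mathrm{context}_k(x_i) = \mathrm{context}_k(x_j)$ and $i \leq j$; if $j_1 \prec \cdots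 \prec j_n$ is the resulting enumeration then $\nu_{k,V}(i) = j_i$; and $M_k(V) = (x_{\nu_{k,V}(1)}, \ldots, x_{\nu_{k,V}(n)})$. *)

theory Defs
  imports "HOL-Library.List_Lexorder" "HOL-Library.Stream"
begin

text \<open>
  Words are lists over a finite linearly ordered type. The orders \<open><\<close> and \<open>\<le>\<close> on words are
  the lexicographic orders of \<open>List_Lexorder\<close>, in which a proper prefix is smaller.
\<close>

definition right_shift :: "'a list \<Rightarrow> 'a list" where
  "right_shift w = (if w = [] then [] else last w # butlast w)"

definition conj_class :: "'a list \<Rightarrow> 'a list list" where
  "conj_class w = map (\<lambda>i. (right_shift ^^ i) w) [0..<length w]"

text \<open>
  \<open>cycle w\<close> is the infinite word \<open>w w w \<dots>\<close>; it is meaningful only for non-empty \<open>w\<close>.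
\<close>

definition word_context :: "nat \<Rightarrow> 'a list \<Rightarrow> 'a list" where
  "word_context k w = stake k (cycle w)"

text \<open>
  The comparison is with the rotations by an amount strictly between \<open>0\<close> and the length, even if
  one of them happens to yield the same word; hence a Lyndon word is primitive.
\<close>

definition lyndon :: "'a::linorder list \<Rightarrow> bool" where
  "lyndon w \<longleftrightarrow> w \<noteq> [] \<and> (\<forall>i. 0 < i \<and> i < length w \<longrightarrow> w < rotate i w)"

text \<open>
  A factorization \<open>w = v\<^sub>s \<cdots> v\<^sub>1\<close> is represented by the list \<open>[v\<^sub>1, \<dots>, v\<^sub>s]\<close>, that is, in the
  order opposite to the occurrence of the factors in \<open>w\<close>.
\<close>

definition is_lyndon_factorization :: "'a::linorder list \<Rightarrow> 'a list list \<Rightarrow> bool" where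
  "is_lyndon_factorization w vs \<longleftrightarrow>
     (\<forall>v \<in> set vs. lyndon v) \<and> sorted vs \<and> concat (rev vs) = w"

definition lyndon_factorization :: "'a::linorder list \<Rightarrow> 'a list list" where
  "lyndon_factorization w = (THE vs. is_lyndon_factorization w vs)"

text \<open>
  Indices of lists start at \<open>0\<close>, so \<open>std_perm k V i\<close> is \<open>\<nu>\<^bsub>k,V\<^esub>(i + 1) - 1\<close>.
\<close>

definition std_le :: "nat \<Rightarrow> 'a::linorder list list \<Rightarrow> nat \<Rightarrow> nat \<Rightarrow> bool" where
  "std_le k V i j \<longleftrightarrow>
     word_context k (V ! i) < word_context k (V ! j) \<or>
     word_context k (V ! i) = word_context k (V ! j) \<and> i \<le> j"

definition std_enum :: "nat \<Rightarrow> 'a::linorder list list \<Rightarrow> nat list" where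
  "std_enum k V =
     (THE js. set js = {..<length V} \<and> sorted_wrt (\<lambda>i j. std_le k V i j \<and> i \<noteq> j) js)"

definition std_perm :: "nat \<Rightarrow> 'a::linorder list list \<Rightarrow> nat \<Rightarrow> nat" where
  "std_perm k V i = std_enum k V ! i"

definition context_sort :: "nat \<Rightarrow> 'a::linorder list list \<Rightarrow> 'a list list" where
  "context_sort k V = map (\<lambda>i. V ! std_perm k V i) [0..<length V]"

definition LST :: "nat \<Rightarrow> 'a::linorder list \<Rightarrow> 'a list" where
  "LST k w = map last (context_sort k (concat (map conj_class (lyndon_factorization w))))"

end

theory Submission
  imports Defs "HOL-Library.Multiset"
begin

text \<open>
  Let \<open>V\<close> be the list \<open>([v\<^sub>1], \<dots>, [v\<^sub>s])\<close>. Reading the last letters of its words in order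
  gives the reversal of \<open>w\<close>, so it suffices to recover from \<open>LST k w\<close> the sequence of pairs
  (context of order \<open>k\<close>, last letter) of \<open>V\<close>. As \<open>right_shift\<close> permutes \<open>V\<close>, the sorted contexts of
  order \<open>j + 1\<close> arise by prepending the letters of \<open>LST k w\<close> to the sorted contexts of order
  \<open>j\<close> and sorting again; hence the stably sorted sequence of pairs is known. To undo the sorting,
  note that a pair determines the context of the next word in its conjugacy class. If some remaining
  pair has this context, the next pair is the first such one; this also covers the step from
  \<open>[v\<^sub>i]\<close> to \<open>[v\<^sub>i\<^sub>+\<^sub>1]\<close> when the contexts of \<open>v\<^sub>i\<close> and \<open>v\<^sub>i\<^sub>+\<^sub>1\<close> agree. Otherwise a new class begins, and
  it begins with the least remaining context, because a Lyndon word has the least context in its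
  class and contexts are monotone on Lyndon words. So the ends of the classes need not be known.
\<close>

section \<open>Lyndon words\<close>

lemma le_append: "u \<le> u @ (v::'a::linorder list)"
  by (induction u) auto

lemma append_le_append_iff: "u @ v \<le> u @ w \<longleftrightarrow> v \<le> (w::'a::linorder list)"
  by (induction u) auto

lemma append_less_append_iff: "u @ v < u @ w \<longleftrightarrow> v < (w::'a::linorder list)"
  by (simp flip: not_le add: append_le_append_iff)

lemma less_cases:
  fixes u v :: "'a::linorder list"
  assumes "u < v"
  obtains (prefix) z where "z \<noteq> []" "v = u @ z"
  | (mismatch) p a b x y where "u = p @ a # x" "v = p @ b # y" "a < b"
  using assms unfolding list_less_def lexord_def by blast

lemma mismatch_less: "a < b \<Longrightarrow> p @ a # x < p @ b # (y::'a::linorder list)"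
  by (induction p) auto

lemma less_append_same_length:
  fixes u v x y :: "'a::linorder list"
  assumes "u @ x < v @ y" and "length u = length v"
  shows "u \<le> v"
proof (rule ccontr)
  assume "\<not> u \<le> v"
  then have "v < u" by simp
  then show False
  proof (cases rule: less_cases)
    case prefix
    then show ?thesis using assms(2) by simp
  next
    case mismatch
    then have "v @ y < u @ x" by (simp add: mismatch_less)
    then show ?thesis using assms(1) by simp
  qed
qed

lemma lyndon_append_less:
  assumes "lyndon (x @ y)" "x \<noteq> []" "y \<noteq> []"
  shows "x @ y < y @ x"
  using assms unfolding lyndon_def
  by (metis (no_types, lifting) add_less_same_cancel1 length_append length_greater_0_conv
      less_add_same_cancel1 rotate_append)

text \<open>Suppose \<open>y < x @ y\<close>. If \<open>x @ y = y @ z\<close>, the rotations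
  \<open>y @ x\<close> and \<open>z @ y\<close> give both \<open>z < x\<close> and
  \<open>x \<le> z\<close>. A mismatch persists in \<open>y @ x < x @ y\<close>.\<close>

lemma lyndon_less_suffix:
  assumes lyndon: "lyndon (x @ y)" and "x \<noteq> []" "y \<noteq> []"
  shows "x @ y < y"
proof (rule ccontr)
  assume "\<not> x @ y < y"
  then have "y < x @ y" using \<open>x \<noteq> []\<close> by (simp add: not_less le_less)
  then show False
  proof (cases rule: less_cases)
    case (prefix z)
    then have len: "length z = length x"
      by (metis add.commute add_left_cancel length_append)
    have "y @ z < y @ x"
      using lyndon_append_less[OF assms] prefix by simp
    then have "z < x" by (simp add: append_less_append_iff)
    moreover have "x @ y < z @ y"
      using lyndon_append_less[of y z] lyndon prefix \<open>y \<noteq> []\<close> by simp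
    then have "x \<le> z" using less_append_same_length len by metis
    ultimately show False by simp
  next
    case (mismatch p a b u v)
    then have "y @ x < x @ y" by (simp add: mismatch_less)
    then show False using lyndon_append_less[OF assms] by simp
  qed
qed

lemma lyndonI_suffix:
  fixes w :: "'a::linorder list"
  assumes "w \<noteq> []" and suffix: "\<And>x y. w = x @ y \<Longrightarrow> x \<noteq> [] \<Longrightarrow> y \<noteq> [] \<Longrightarrow> w < y"
  shows "lyndon w"
  unfolding lyndon_def
proof (intro conjI allI impI)
  fix i assume i: "0 < i \<and> i < length w"
  have "w < drop i w" using i by (intro suffix[of "take i w"]) auto
  also have "\<dots> \<le> rotate i w" using i by (simp add: rotate_drop_take le_append)
  finally show "w < rotate i w" .
qed fact

section \<open>The Lyndon factorization\<close>

text \<open>Induction strips the greatest factor \<open>u\<close>, which comes first in the word. If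
  \<open>y\<close> starts inside it, with part \<open>s\<close> in \<open>u\<close>, then
  \<open>v \<le> u \<le> s \<le> y\<close>.\<close>

lemma lyndon_factor_le_suffix:
  assumes "sorted (v # vs)" "\<forall>u\<in>set (v # vs). lyndon u"
    and "concat (rev (v # vs)) = x @ y" "y \<noteq> []"
  shows "v \<le> y"
  using assms
proof (induction vs arbitrary: x y rule: rev_induct)
  case Nil
  then show ?case
    using lyndon_less_suffix[of x y] by (cases "x = []") auto
next
  case (snoc u vs)
  have split: "u @ concat (rev (v # vs)) = x @ y" using snoc.prems by simp
  show ?case
  proof (cases "length u \<le> length x")
    case True
    then have "concat (rev (v # vs)) = drop (length u) x @ y"
      using arg_cong[OF split, of "drop (length u)"] by simp
    moreover have "sorted (v # vs)" "\<forall>u\<in>set (v # vs). lyndon u"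
      using snoc.prems by (auto simp: sorted_append)
    ultimately show ?thesis using snoc.IH snoc.prems(4) by blast
  next
    case False
    define s where "s = drop (length x) u"
    have s: "u = x @ s" "y = s @ concat (rev (v # vs))" "s \<noteq> []"
      using False arg_cong[OF split, of "take (length x)"] arg_cong[OF split, of "drop (length x)"]
        append_take_drop_id[of "length x" u]
      by (auto simp: s_def)
    have "v \<le> u" using snoc.prems(1) by simp
    also have "u \<le> s"
      using lyndon_less_suffix[of x s] snoc.prems(2) s by (cases "x = []") auto
    also have "s \<le> y" using s le_append by blast
    finally show ?thesis .
  qed
qed

text \<open>By the preceding lemma the final factor is the least non-empty suffix of
  \<open>w\<close>.\<close>

lemma lyndon_factorization_unique:
  assumes "is_lyndon_factorization w us" "is_lyndon_factorization w vs"
  shows "us = vs"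
  using assms
proof (induction us arbitrary: w vs)
  case Nil
  then show ?case
    by (cases vs) (auto simp: is_lyndon_factorization_def lyndon_def)
next
  case (Cons u us)
  have u: "u \<noteq> []" using Cons.prems by (auto simp: is_lyndon_factorization_def lyndon_def)
  then obtain v vs' where vs: "vs = v # vs'"
    using Cons.prems by (cases vs) (auto simp: is_lyndon_factorization_def)
  then have v: "v \<noteq> []" using Cons.prems by (auto simp: is_lyndon_factorization_def lyndon_def)
  have "u \<le> v"
    using Cons.prems vs v lyndon_factor_le_suffix[of u us "concat (rev vs')" v]
    by (auto simp: is_lyndon_factorization_def)
  moreover have "v \<le> u"
    using Cons.prems vs u lyndon_factor_le_suffix[of v vs' "concat (rev us)" u]
    by (auto simp: is_lyndon_factorization_def)
  ultimately have "u = v" by simp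
  moreover from this have "us = vs'"
    using Cons.prems vs by (intro Cons.IH[of "concat (rev us)"]) (auto simp: is_lyndon_factorization_def)
  ultimately show ?case using vs by simp
qed

lemma least_suffix_exists:
  fixes w :: "'a::linorder list"
  assumes "w \<noteq> []"
  obtains x v where "w = x @ v" "v \<noteq> []" "\<forall>y z. w = y @ z \<longrightarrow> z \<noteq> [] \<longrightarrow> v \<le> z"
proof -
  define A where "A = {z. z \<noteq> [] \<and> (\<exists>y. w = y @ z)}"
  have "A \<subseteq> (\<lambda>i. drop i w) ` {..length w}"
  proof
    fix z assume "z \<in> A"
    then obtain y where "w = y @ z" by (auto simp: A_def)
    then have "z = drop (length y) w" "length y \<le> length w" by auto
    then show "z \<in> (\<lambda>i. drop i w) ` {..length w}" by blast
  qed
  then have fin: "finite A" by (rule finite_subset) simp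
  have "w \<in> A" using assms by (simp add: A_def)
  then have "Min A \<in> A" using fin by (intro Min_in) auto
  then obtain x where "w = x @ Min A" "Min A \<noteq> []" by (auto simp: A_def)
  moreover have "Min A \<le> z" if "w = y @ z" "z \<noteq> []" for y z
    using fin that by (intro Min_le) (auto simp: A_def)
  ultimately show thesis using that by blast
qed

text \<open>The least non-empty suffix \<open>v\<close> is split off; minimality makes it Lyndon,
  and the rest is factored by induction.\<close>

lemma lyndon_factorization_exists: "\<exists>vs. is_lyndon_factorization w vs"
proof (induction "length w" arbitrary: w rule: less_induct)
  case less
  show ?case
  proof (cases "w = []")
    case True
    then have "is_lyndon_factorization w []" by (simp add: is_lyndon_factorization_def)
    then show ?thesis by blast
  next
    case False
    obtain x v where xv: "w = x @ v" "v \<noteq> []"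
      and least: "\<And>y z. w = y @ z \<Longrightarrow> z \<noteq> [] \<Longrightarrow> v \<le> z"
      using least_suffix_exists[OF False] by metis
    have proper: "v < z" if "v = y @ z" "y \<noteq> []" "z \<noteq> []" for y z
      using least[of "x @ y" z] xv that by (auto simp: le_less)
    have lyndon_v: "lyndon v"
      using xv(2) proper by (rule lyndonI_suffix)
    obtain vs where vs: "is_lyndon_factorization x vs"
      using less xv by fastforce
    \<comment> \<open>Here \<open>u\<close> is the last factor of \<open>x\<close>, so the suffix
      \<open>u @ v\<close> of \<open>w\<close> cannot be below \<open>v\<close>; if
      \<open>v = u @ z\<close>, this forces \<open>z \<le> v\<close>.\<close>
    have "v \<le> u" if "vs = u # us" for u us
    proof (rule ccontr)
      assume "\<not> v \<le> u"
      then have "u < v" by simp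
      have u: "u \<noteq> []" using vs that by (auto simp: is_lyndon_factorization_def lyndon_def)
      have uv: "v \<le> u @ v"
        using vs xv that by (intro least[of "concat (rev us)"]) (auto simp: is_lyndon_factorization_def)
      from \<open>u < v\<close> show False
      proof (cases rule: less_cases)
        case (prefix z)
        then have "z \<le> v" using uv append_le_append_iff by metis
        then show False using proper[OF prefix(2) u prefix(1)] by simp
      next
        case (mismatch p a b y z)
        then have "u @ v < v" by (simp add: mismatch_less)
        then show False using uv by simp
      qed
    qed
    then have "is_lyndon_factorization w (v # vs)"
      using vs xv lyndon_v by (cases vs) (auto simp: is_lyndon_factorization_def)
    then show ?thesis by blast
  qed
qed

lemma is_lyndon_factorization_lyndon_factorization:
  "is_lyndon_factorization w (lyndon_factorization w)"
  unfolding lyndon_factorization_def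
  by (rule theI') (use lyndon_factorization_exists lyndon_factorization_unique in blast)

section \<open>Contexts\<close>

lemma stake_mismatch_le:
  fixes a b :: "'a::linorder"
  assumes "a < b"
  shows "stake k ((p @ a # x) @- s) \<le> stake k ((p @ b # y) @- t)"
proof (induction p arbitrary: k)
  case Nil
  then show ?case using assms by (cases k) auto
next
  case (Cons c p)
  then show ?case by (cases k) auto
qed

lemma stake_shift_mono:
  fixes s t :: "'a::linorder stream"
  assumes "stake (k - length v) s \<le> stake (k - length v) t"
  shows "stake k (v @- s) \<le> stake k (v @- t)"
  using assms
proof (induction v arbitrary: k)
  case Nil
  then show ?case by simp
next
  case (Cons a v)
  then show ?case by (cases k) auto
qed

lemma cycle_shift: "v \<noteq> [] \<Longrightarrow> cycle v = v @- cycle v"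
  by (rule cycle_decomp)

lemma word_context_le_same_length:
  fixes u v :: "'a::linorder list"
  assumes "u \<le> v" "length u = length v" "u \<noteq> []"
  shows "word_context k u \<le> word_context k v"
proof (cases "u = v")
  case False
  then have "u < v" using assms by simp
  then show ?thesis
  proof (cases rule: less_cases)
    case (prefix z)
    then show ?thesis using assms by simp
  next
    case (mismatch p a b x y)
    then have "v \<noteq> []" by simp
    then show ?thesis
      unfolding word_context_def using assms(3) mismatch
      by (metis cycle_shift stake_mismatch_le)
  qed
qed simp

text \<open>Iterating the hypothesis puts any number of copies of \<open>v\<close> in front of
  \<open>s\<close>; enough of them cover the first \<open>k\<close> letters.\<close>

lemma stake_cycle_le_if_shift_le:
  fixes s :: "'a::linorder stream"
  assumes "v \<noteq> []" "\<And>k. stake k (v @- s) \<le> stake k s"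
  shows "stake k (cycle v) \<le> stake k s"
proof (induction k rule: less_induct)
  case (less k)
  show ?case
  proof (cases "k = 0")
    case False
    have "stake (k - length v) (cycle v) \<le> stake (k - length v) s"
      using False assms(1) by (intro less.IH) simp
    then have "stake k (v @- cycle v) \<le> stake k (v @- s)" by (rule stake_shift_mono)
    also have "\<dots> \<le> stake k s" by (rule assms(2))
    finally show ?thesis using cycle_shift[OF assms(1)] by simp
  qed simp
qed

lemma cycle_append: "v \<noteq> [] \<Longrightarrow> cycle (v @ z) = v @- cycle (z @ v)"
proof (induction v arbitrary: z)
  case Nil
  then show ?case by simp
next
  case (Cons a v)
  then show ?case
    by (cases "v = []") (simp_all add: cycle_Cons)
qed

text \<open>A mismatch persists in the infinite powers. The prefix case needs the Lyndon property:
  for letters a < b, the word b is below ba, yet baba... is below bbbb...\<close>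

lemma word_context_le_lyndon:
  assumes "u \<le> v" "lyndon u" "lyndon v"
  shows "word_context k u \<le> word_context k v"
proof (cases "u = v")
  case False
  then have "u < v" using assms by simp
  have ne: "u \<noteq> []" "v \<noteq> []" using assms by (auto simp: lyndon_def)
  from \<open>u < v\<close> show ?thesis
  proof (cases rule: less_cases)
    case (prefix z)
    have "u @ z \<le> z @ u"
      using lyndon_append_less[of u z] prefix ne assms by simp
    then have le: "stake m (cycle (u @ z)) \<le> stake m (cycle (z @ u))" for m
      using word_context_le_same_length[of "u @ z" "z @ u" m] ne
      by (simp add: word_context_def)
    \<comment> \<open>\<open>(u z)\<^sup>\<omega> = u (z u)\<^sup>\<omega>\<close> dominates \<open>u (u z)\<^sup>\<omega>\<close>, hence all \<open>u\<^sup>i (u z)\<^sup>\<omega>\<close>.\<close>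
    have "stake m (u @- cycle (u @ z)) \<le> stake m (cycle (u @ z))" for m
      using le stake_shift_mono cycle_append[OF ne(1), of z] by metis
    then show ?thesis
      unfolding word_context_def prefix by (rule stake_cycle_le_if_shift_le[OF ne(1)])
  next
    case (mismatch p a b x y)
    then show ?thesis
      unfolding word_context_def using ne by (metis cycle_shift stake_mismatch_le)
  qed
qed simp

lemma take_mono_lex: "xs \<le> ys \<Longrightarrow> take j xs \<le> take j (ys :: 'a::linorder list)"
proof (induction xs arbitrary: j ys)
  case Nil
  then show ?case by simp
next
  case (Cons x xs)
  then show ?case by (cases ys; cases j) auto
qed

lemma take_word_context: "j \<le> k \<Longrightarrow> take j (word_context k x) = word_context j x"
  by (simp add: word_context_def take_stake min_def)

section \<open>Conjugacy classes\<close>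

lemma right_shift_rotate1: "right_shift (rotate1 v) = v"
  by (cases v) (auto simp: right_shift_def)

lemma funpow_right_shift:
  "i \<le> length v \<Longrightarrow> (right_shift ^^ i) v = rotate (length v - i) v"
proof (induction i)
  case 0
  then show ?case by simp
next
  case (Suc i)
  then have "length v - i = Suc (length v - Suc i)" by simp
  then show ?case using Suc by (simp add: right_shift_rotate1)
qed

lemma conj_class_nonempty: "x \<in> set (conj_class v) \<Longrightarrow> x \<noteq> []"
  by (auto simp: conj_class_def funpow_right_shift)

lemma map_last_conj_class: "map last (conj_class v) = rev v"
proof (rule nth_equalityI)
  fix i assume "i < length (map last (conj_class v))"
  then have i: "i < length v" by (simp add: conj_class_def)
  then have "length v - i = Suc (length v - Suc i)" by simp
  moreover have "last (rotate1 u) = hd u" if "u \<noteq> []" for u :: "'a list"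
    using that by (cases u) auto
  moreover have "rotate (length v - Suc i) v \<noteq> []" using i by auto
  ultimately have "last ((right_shift ^^ i) v) = hd (rotate (length v - Suc i) v)"
    using i by (metis funpow_right_shift less_imp_le rotate_Suc)
  also have "\<dots> = v ! (length v - Suc i)"
    using i by (subst hd_rotate_conv_nth) auto
  finally show "map last (conj_class v) ! i = rev v ! i"
    using i by (simp add: conj_class_def rev_nth)
qed (simp add: conj_class_def)

lemma mset_map_right_shift_conj_class:
  "mset (map right_shift (conj_class v)) = mset (conj_class v)"
proof -
  \<comment> \<open>The powers 0 to \<open>length v\<close> are listed in two ways; the first and
    the last both equal \<open>v\<close> and cancel.\<close>
  have "mset (map (\<lambda>i. (right_shift ^^ i) v) [0..<Suc (length v)])
      = mset (map (\<lambda>i. (right_shift ^^ i) v) (0 # map Suc [0..<length v]))"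
    by (simp only: upt_conv_Cons map_Suc_upt zero_less_Suc)
  then show ?thesis
    by (simp add: conj_class_def funpow_right_shift comp_def)
qed

lemma word_context_Suc_right_shift:
  "x \<noteq> [] \<Longrightarrow> word_context (Suc j) (right_shift x) = last x # word_context j x"
  by (simp add: word_context_def right_shift_def cycle_Cons)

text \<open>Only the context and last letter of \<open>x\<close> enter the right-hand side, so this
  pair predicts the context of the next conjugate.\<close>

lemma word_context_right_shift:
  assumes "x \<noteq> []"
  shows "word_context k (right_shift x) = take k (last x # word_context k x)"
  using word_context_Suc_right_shift[OF assms, of k] take_word_context[of k "Suc k"]
  by (metis le_add2 plus_1_eq_Suc)

lemma word_context_lyndon_le_conj_class:
  assumes "lyndon v" "x \<in> set (conj_class v)"
  shows "word_context k v \<le> word_context k x"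
proof -
  obtain i where i: "i < length v" "x = rotate (length v - i) v"
    using assms(2) by (auto simp: conj_class_def funpow_right_shift)
  have "v \<le> x"
  proof (cases "i = 0")
    case False
    then show ?thesis using assms(1) i by (auto simp: lyndon_def intro!: less_imp_le)
  qed (use i in simp)
  then show ?thesis
    using i assms(1) by (intro word_context_le_same_length) (auto simp: lyndon_def)
qed

section \<open>Context sorting as a stable sort\<close>

text \<open>Asymmetry excludes repetitions and forces equal heads. This makes the enumeration in
  \<open>std_enum\<close> unique.\<close>

lemma sorted_wrt_unique:
  assumes "sorted_wrt R xs" "sorted_wrt R ys" "set xs = set ys"
    and asym: "\<And>x y. R x y \<Longrightarrow> \<not> R y x"
  shows "xs = ys"
  using assms(1-3)
proof (induction xs arbitrary: ys)
  case Nil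
  then show ?case by simp
next
  case (Cons x xs)
  then obtain y ys' where ys: "ys = y # ys'" by (cases ys) auto
  have "x = y"
    using Cons.prems ys asym by (metis list.set_intros(1) set_ConsD sorted_wrt.simps(2))
  moreover have "x \<notin> set xs" "y \<notin> set ys'"
    using Cons.prems(1,2) ys asym by (metis sorted_wrt.simps(2))+
  ultimately have "set xs = set ys'"
    using Cons.prems ys by auto
  then show ?case using Cons ys \<open>x = y\<close> by simp
qed

text \<open>Stability: each new index is smaller than those already inserted, and
  \<open>insort_key\<close> puts it in front of equal keys.\<close>

lemma sorted_wrt_sort_key:
  fixes f :: "'i::linorder \<Rightarrow> 'b::linorder"
  assumes "sorted_wrt (<) js"
  shows "sorted_wrt (\<lambda>i j. f i < f j \<or> f i = f j \<and> i < j) (sort_key f js)"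
  using assms
proof (induction js)
  case Nil
  then show ?case by simp
next
  case (Cons i js)
  have "sorted_wrt (\<lambda>i j. f i < f j \<or> f i = f j \<and> i < j) (insort_key f i xs)"
    if "sorted_wrt (\<lambda>i j. f i < f j \<or> f i = f j \<and> i < j) xs" "\<forall>j\<in>set xs. i < j" for xs
    using that by (induction xs) (force simp: set_insort_key)+
  then show ?case using Cons by simp
qed

lemma sort_key_map: "sort_key f (map g xs) = map g (sort_key (f \<circ> g) xs)"
proof (induction xs)
  case (Cons x xs)
  have "insort_key f (g x) (map g ys) = map g (insort_key (f \<circ> g) x ys)" for ys
    by (induction ys) auto
  from this[of "sort_key (f \<circ> g) xs"] show ?case using Cons by (simp del: comp_apply)
qed simp

lemma context_sort_eq_sort_key: "context_sort k V = sort_key (word_context k) V"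
proof -
  define js where "js = sort_key (word_context k \<circ> nth V) [0..<length V]"
  have rel: "(\<lambda>i j. std_le k V i j \<and> i \<noteq> j) = (\<lambda>i j. (word_context k \<circ> nth V) i < (word_context k \<circ> nth V) j
      \<or> (word_context k \<circ> nth V) i = (word_context k \<circ> nth V) j \<and> i < j)"
    by (auto simp: std_le_def fun_eq_iff)
  have js: "sorted_wrt (\<lambda>i j. std_le k V i j \<and> i \<noteq> j) js"
    unfolding rel js_def by (intro sorted_wrt_sort_key) simp
  have set_js: "set js = {..<length V}" and length_js: "length js = length V"
    by (auto simp: js_def)
  have "std_enum k V = js"
    unfolding std_enum_def
  proof (rule the_equality)
    show "set js = {..<length V} \<and> sorted_wrt (\<lambda>i j. std_le k V i j \<and> i \<noteq> j) js"
      using js set_js by blast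
  next
    fix ks assume ks: "set ks = {..<length V} \<and> sorted_wrt (\<lambda>i j. std_le k V i j \<and> i \<noteq> j) ks"
    have "\<not> (std_le k V j i \<and> j \<noteq> i)" if "std_le k V i j \<and> i \<noteq> j" for i j
      using that unfolding std_le_def by (metis less_asym less_irrefl order_antisym)
    with ks js set_js show "ks = js"
      by (metis (mono_tags, lifting) sorted_wrt_unique)
  qed
  then have "context_sort k V = map (nth V) (map (nth js) [0..<length js])"
    by (simp add: context_sort_def std_perm_def length_js)
  also have "\<dots> = map (nth V) js" by (simp only: map_nth)
  also have "\<dots> = sort_key (word_context k) (map (nth V) [0..<length V])"
    unfolding js_def by (rule sort_key_map[symmetric])
  finally show ?thesis by (simp only: map_nth)
qed

section \<open>Recovering the contexts\<close>

text \<open>The column-by-column reconstruction that inverts the Burrows-Wheeler transform, with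
  \<open>L\<close> as the last column.\<close>

fun sorted_contexts :: "nat \<Rightarrow> 'a::linorder list \<Rightarrow> 'a list list" where
  "sorted_contexts 0 L = map (\<lambda>_. []) L"
| "sorted_contexts (Suc j) L = sort (map2 (#) L (sorted_contexts j L))"

lemma map_word_context_eq_sorted_contexts:
  assumes nonempty: "\<forall>x\<in>set U. x \<noteq> []"
    and shift: "mset (map right_shift U) = mset U"
    and sorted: "sorted (map (word_context k) U)"
    and "j \<le> k"
  shows "map (word_context j) U = sorted_contexts j (map last U)"
  using \<open>j \<le> k\<close>
proof (induction j)
  case 0
  then show ?case by (simp add: word_context_def comp_def)
next
  case (Suc j)
  \<comment> \<open>Truncation is monotone, so sorting by order \<open>k\<close> also sorts by order
    \<open>Suc j \<le> k\<close>.\<close>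
  have "sorted (map (take (Suc j)) (map (word_context k) U))"
    using sorted by (auto simp: sorted_map intro: sorted_wrt_mono_rel[rotated] take_mono_lex)
  then have sorted_j: "sorted (map (word_context (Suc j)) U)"
    using Suc.prems by (simp add: take_word_context comp_def)
  have "map2 (#) (map last U) (map (word_context j) U) = map (\<lambda>x. last x # word_context j x) U"
    by (induction U) auto
  also have "\<dots> = map (word_context (Suc j)) (map right_shift U)"
    using nonempty by (simp add: word_context_Suc_right_shift)
  also have "mset \<dots> = mset (map (word_context (Suc j)) U)"
    using shift by (metis mset_map)
  finally have "sort (map2 (#) (map last U) (map (word_context j) U)) = map (word_context (Suc j)) U"
    using sorted_j by (intro properties_for_sort) simp_all
  then show ?case
    using Suc by simp
qed

section \<open>Greedy schedules\<close>

definition pick :: "'b::linorder \<Rightarrow> 'b set \<Rightarrow> 'b" where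
  "pick p D = (if p \<in> D then p else Min D)"

text \<open>
  \<open>p\<close> is the key predicted for the first entry, and \<open>f d a\<close> the one predicted after the entry
  \<open>(d, a)\<close>; when no remaining entry has the predicted key, the least remaining key is taken.
\<close>

fun greedy :: "('b::linorder \<Rightarrow> 'a \<Rightarrow> 'b) \<Rightarrow> 'b \<Rightarrow> ('b \<times> 'a) list \<Rightarrow> bool" where
  "greedy f p [] = True"
| "greedy f p ((d, a) # S) \<longleftrightarrow> d = pick p (insert d (fst ` set S)) \<and> greedy f (f d a) S"

lemma greedy_fst: "greedy f p (s # S) \<Longrightarrow> fst s = pick p (fst ` set (s # S))"
  by (cases s) simp

text \<open>The common sorted list fixes the available keys, hence the first key. Stability then
  fixes which entry with that key comes first; removing it leaves the tails.\<close>

lemma greedy_unique: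
  assumes "greedy f p S" "greedy f p T" "sort_key fst S = sort_key fst T"
  shows "S = T"
  using assms
proof (induction S arbitrary: p T)
  case Nil
  then show ?case by (metis length_0_conv length_sort)
next
  case (Cons s S)
  obtain t T' where T: "T = t # T'"
    using Cons.prems(3) by (metis length_0_conv length_sort list.exhaust list.distinct(1))
  have "set (s # S) = set T" using Cons.prems(3) by (metis set_sort)
  then have "fst ` set (s # S) = fst ` set T" by simp
  then have fst: "fst s = fst t"
    using Cons.prems(1,2) T greedy_fst by metis
  have "filter (\<lambda>x. fst x = fst s) (s # S) = filter (\<lambda>x. fst x = fst s) T"
    using Cons.prems(3) by (metis sort_key_stable)
  then have "s = t" using fst T by simp
  moreover have "sort_key fst S = sort_key fst T'"
    using Cons.prems(3) T \<open>s = t\<close> by (simp, metis remove1_insort_key)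
  ultimately show ?case
    using Cons.prems(1,2) T by (cases s) (auto intro: Cons.IH)
qed

section \<open>Conjugacy classes as a greedy schedule\<close>

definition keyed :: "nat \<Rightarrow> 'a list \<Rightarrow> 'a list \<times> 'a" where
  "keyed k x = (word_context k x, last x)"

abbreviation next_context :: "nat \<Rightarrow> 'a list \<Rightarrow> 'a \<Rightarrow> 'a list" where
  "next_context k d a \<equiv> take k (a # d)"

text \<open>Inside a class every prediction is correct. After \<open>length v\<close> shifts the
  word is \<open>v\<close> again, so \<open>S\<close> is entered with the prediction
  \<open>word_context k v\<close>.\<close>

lemma greedy_conj_class_tail:
  assumes "greedy (next_context k) (word_context k v) S" "m \<le> length v"
  shows "greedy (next_context k) (word_context k ((right_shift ^^ m) v))
    (map (keyed k) (map (\<lambda>i. (right_shift ^^ i) v) [m..<length v]) @ S)"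
  using assms(2)
proof (induction m rule: inc_induct)
  case base
  then show ?case using assms(1) by (simp add: funpow_right_shift)
next
  case (step m)
  have "(right_shift ^^ m) v \<noteq> []"
    using step by (auto simp: funpow_right_shift)
  from word_context_right_shift[OF this, of k] show ?case
    using step by (simp add: upt_conv_Cons keyed_def pick_def)
qed

text \<open>The bound on \<open>p\<close> survives the induction: after the class of
  \<open>v\<close> the prediction is the context of \<open>v\<close>, a lower bound for those that
  remain.\<close>

lemma greedy_conj_classes:
  assumes "sorted vs" "\<forall>v\<in>set vs. lyndon v"
    and "\<forall>x\<in>set (concat (map conj_class vs)). p \<le> word_context k x"
  shows "greedy (next_context k) p (map (keyed k) (concat (map conj_class vs)))"
  using assms
proof (induction vs arbitrary: p)
  case Nil
  then show ?case by simp
next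
  case (Cons v vs)
  define R where "R = concat (map conj_class vs)"
  have v: "lyndon v" "v \<noteq> []" using Cons.prems by (auto simp: lyndon_def)
  have least: "word_context k v \<le> word_context k x" if x: "x \<in> set (conj_class v @ R)" for x
  proof -
    obtain u where u: "u \<in> set (v # vs)" "x \<in> set (conj_class u)"
      using x by (auto simp: R_def)
    have "word_context k v \<le> word_context k u"
      using u Cons.prems by (intro word_context_le_lyndon) auto
    also have "\<dots> \<le> word_context k x"
      using u Cons.prems by (intro word_context_lyndon_le_conj_class) auto
    finally show ?thesis .
  qed
  have "greedy (next_context k) (word_context k v) (map (keyed k) R)"
    unfolding R_def using Cons.prems least by (intro Cons.IH) (auto simp: R_def)
  from greedy_conj_class_tail[OF this, of 0]
  have g: "greedy (next_context k) (word_context k v) (map (keyed k) (conj_class v @ R))"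
    by (simp add: conj_class_def)
  obtain C where C: "conj_class v @ R = v # C"
    using v by (simp add: conj_class_def upt_conv_Cons)
  define D where "D = insert (word_context k v) (fst ` set (map (keyed k) C))"
  have D: "D = word_context k ` set (conj_class v @ R)"
    unfolding C D_def by (auto simp: keyed_def image_image)
  have "Min D = word_context k v"
    using least unfolding D by (intro Min_eqI) (auto simp: C)
  \<comment> \<open>As a lower bound, \<open>p\<close> can occur only as the least key
    \<open>word_context k v\<close>; if it does not occur, \<open>pick\<close> takes that same key
    as the minimum.\<close>
  moreover have "p = word_context k v" if "p \<in> D"
  proof (rule antisym)
    have "v \<in> set (conj_class v @ R)" using C by simp
    then show "p \<le> word_context k v" using Cons.prems(3) by (auto simp: R_def)
    show "word_context k v \<le> p" using that least unfolding D by auto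
  qed
  ultimately have "word_context k v = pick p D" by (auto simp: pick_def)
  then have "greedy (next_context k) p (map (keyed k) (conj_class v @ R))"
    using g by (simp add: C keyed_def D_def)
  then show ?case by (simp add: R_def)
qed

section \<open>Injectivity of the transform\<close>

definition conjugates :: "'a::linorder list \<Rightarrow> 'a list list" where
  "conjugates w = concat (map conj_class (lyndon_factorization w))"

lemma map_last_conjugates: "map last (conjugates w) = rev w"
proof -
  have "map last (conjugates w) = concat (map rev (lyndon_factorization w))"
    by (simp add: conjugates_def map_concat comp_def map_last_conj_class)
  also have "\<dots> = rev (concat (rev (lyndon_factorization w)))"
    by (simp add: rev_concat)
  also have "\<dots> = rev w"
    using is_lyndon_factorization_lyndon_factorization[of w] by (simp add: is_lyndon_factorization_def)
  finally show ?thesis .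
qed

text \<open>The right-hand side involves \<open>w\<close> only through
  \<open>LST k w\<close>.\<close>

lemma sort_key_keyed_conjugates:
  "sort_key fst (map (keyed k) (conjugates w)) = zip (sorted_contexts k (LST k w)) (LST k w)"
proof -
  define U where "U = sort_key (word_context k) (conjugates w)"
  have L: "LST k w = map last U"
    by (simp add: LST_def U_def conjugates_def context_sort_eq_sort_key)
  have "mset (map right_shift (conjugates w)) = mset (conjugates w)"
    by (simp add: conjugates_def map_concat mset_concat comp_def mset_map_right_shift_conj_class
        del: mset_map)
  then have "mset (map right_shift U) = mset U" by (simp add: U_def)
  moreover have "\<forall>x\<in>set U. x \<noteq> []"
    by (auto simp: U_def conjugates_def dest: conj_class_nonempty)
  moreover have "sorted (map (word_context k) U)" by (simp add: U_def)
  ultimately have "map (word_context k) U = sorted_contexts k (LST k w)"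
    unfolding L by (intro map_word_context_eq_sorted_contexts) auto
  moreover have "sort_key fst (map (keyed k) (conjugates w)) = map (keyed k) U"
    by (simp add: sort_key_map U_def keyed_def comp_def)
  moreover have "map (keyed k) U = zip (map (word_context k) U) (map last U)"
    by (induction U) (auto simp: keyed_def)
  ultimately show ?thesis by (simp add: L)
qed

lemma inj_LST: "inj (LST k :: 'a::linorder list \<Rightarrow> 'a list)"
proof (rule injI)
  fix w w' :: "'a list"
  assume eq: "LST k w = LST k w'"
  \<comment> \<open>The initial prediction \<open>[]\<close> lies below every context.\<close>
  have "greedy (next_context k) [] (map (keyed k) (conjugates u))" for u :: "'a list"
    unfolding conjugates_def using is_lyndon_factorization_lyndon_factorization[of u]
    by (intro greedy_conj_classes) (auto simp: is_lyndon_factorization_def)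
  moreover have "sort_key fst (map (keyed k) (conjugates w)) = sort_key fst (map (keyed k) (conjugates w'))"
    by (simp only: sort_key_keyed_conjugates eq)
  ultimately have "map (keyed k) (conjugates w) = map (keyed k) (conjugates w')"
    by (metis greedy_unique)
  then have "map snd (map (keyed k) (conjugates w)) = map snd (map (keyed k) (conjugates w'))"
    by (rule arg_cong)
  then have "rev w = rev w'"
    by (simp add: comp_def keyed_def flip: map_last_conjugates)
  then show "w = w'" by simp
qed

theorem theorem2:
  fixes k :: nat
  shows "\<exists>g :: 'a::{finite, linorder} list \<Rightarrow> 'a list. \<forall>w. w \<noteq> [] \<longrightarrow> g (LST k w) = w"
  using inj_LST inv_f_f by metis

end
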